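(* Let $A$ be a $2\times 2$ complex matrix with eigenvalues $a$ and $b$. Then the numerical range $W(A)$ is an elliptical disk with foci at $a$ and $b$ and minor axis of length $\left(\operatorname{tr}(A^\star A)-|a|^2-|b|^2\right)^{1/2}$.
   Context: For an $n\times n$ complex matrix $B$, the numerical range is $W(B)=\{\langle Bx,x\rangle : x\in\mathbb{C}^n,\ \|x\|=1\}\subseteq\mathbb{C}$, with the standard inner product and norm. $A^\star$ denotes the conjugate transpose of $A$. Eigenvalues are listed with algebraic multiplicity, so $a=b$ is allowed. An elliptical disk means a closed elliptical disk (the ellipse together with its interior), possibly degenerate: the elliptical disk with foci $a,b$ and minor axis of (full) length $p\ge 0$ is $\{z\in\mathbb{C}: |z-a|+|z-b|\le \sqrt{|a-b|^2+p^2}\}$. In particular it is a closed circular disk centered at $a$ of diameter $p$ if $a=b$, and the closed line segment from $a$ to $b$ if $p=0$. *)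

theory Defs
  imports "Jordan_Normal_Form.Schur_Decomposition"
begin

definition mat_tr :: "complex mat \<Rightarrow> complex" where
  "mat_tr A = (\<Sum>i<dim_row A. A $$ (i, i))"

definition vec_l2norm :: "complex vec \<Rightarrow> real" where
  "vec_l2norm x = sqrt (\<Sum>i<dim_vec x. (cmod (x $ i))\<^sup>2)"

(* \<bullet>c conjugates its second argument, so it is \<langle>Bx, x\<rangle>, linear in the first slot. *)
definition numerical_range :: "complex mat \<Rightarrow> complex set" where
  "numerical_range B =
     {(B *\<^sub>v x) \<bullet>c x | x. x \<in> carrier_vec (dim_col B) \<and> vec_l2norm x = 1}"

(* Closed elliptical disk with foci a, b and minor axis of full length p \<ge> 0; the major axis
   then has full length sqrt (|a - b|^2 + p^2).  Degenerate cases are allowed: a circular disk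
   of diameter p if a = b, a line segment if p = 0. *)
definition elliptical_disk :: "complex \<Rightarrow> complex \<Rightarrow> real \<Rightarrow> complex set" where
  "elliptical_disk a b p =
     {z. cmod (z - a) + cmod (z - b) \<le> sqrt ((cmod (a - b))\<^sup>2 + p\<^sup>2)}"

end

theory Submission
  imports Defs
begin

text \<open>
  A unitary change of basis makes \<open>A\<close> upper triangular with diagonal \<open>a, b\<close> and corner entry \<open>c\<close>.
  It changes neither the numerical range nor \<open>tr (A\<^sup>* A)\<close>, which thus equals \<open>|a|\<^sup>2 + |b|\<^sup>2 + |c|\<^sup>2\<close>, so the
  minor axis has to be \<open>|c|\<close>. For a unit vector \<open>(x, y)\<close> with \<open>t = |x|\<^sup>2\<close> the triangular form takes the value
  \<open>t a + (1 - t) b + c y x\<^sup>*\<close>, so \<open>z\<close> lies in the numerical range iff, for some \<open>t\<close> in \<open>[0, 1]\<close>, its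
  distance to \<open>t a + (1 - t) b\<close> has square \<open>t (1 - t) |c|\<^sup>2\<close>. With \<open>P = |z - a|\<close>, \<open>Q = |z - b|\<close> and
  \<open>S = |a - b|\<^sup>2 + |c|\<^sup>2\<close>, Stewart's theorem rewrites this condition as
  \<open>t P\<^sup>2 + (1 - t) Q\<^sup>2 = t (1 - t) S\<close>. A solution satisfies \<open>(P + Q)\<^sup>2 \<le> S\<close> by the Cauchy-Schwarz
  inequality; conversely, if \<open>(P + Q)\<^sup>2 \<le> S\<close>, then the difference of the two sides is nonnegative
  at \<open>t = 0\<close> and nonpositive at \<open>t = Q / (P + Q)\<close>, so it vanishes in between.
\<close>

section \<open>Characteristic polynomial of a 2 x 2 matrix\<close>

lemma det_mat_2:
  fixes A :: "'a :: comm_ring_1 mat"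
  assumes "A \<in> carrier_mat 2 2"
  shows "det A = A $$ (0,0) * A $$ (1,1) - A $$ (0,1) * A $$ (1,0)"
proof -
  have "det (mat_delete A i 0) = A $$ (1 - i, 1)" if "i < 2" for i
  proof -
    have "mat_delete A i 0 \<in> carrier_mat 1 1"
      using mat_delete_carrier[OF assms, of i 0] by simp
    then show ?thesis
      using assms that by (subst det_single) (auto simp: mat_delete_def less_2_cases_iff)
  qed
  then show ?thesis
    using laplace_expansion_column[OF assms, of 0]
    by (simp add: cofactor_def numeral_2_eq_2 lessThan_Suc mult.commute)
qed

lemma char_poly_mat_2:
  fixes A :: "'a :: comm_ring_1 mat"
  assumes "A \<in> carrier_mat 2 2"
  shows "char_poly A = [: A $$ (0,0) * A $$ (1,1) - A $$ (0,1) * A $$ (1,0),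
                          - (A $$ (0,0) + A $$ (1,1)), 1 :]"
proof -
  have "char_poly_matrix A \<in> carrier_mat 2 2"
    using assms by simp
  then show ?thesis
    unfolding char_poly_def using assms
    by (subst det_mat_2) (auto simp: char_poly_matrix_def algebra_simps)
qed

lemma eigenvalues_mat_2:
  fixes A :: "complex mat"
  assumes A: "A \<in> carrier_mat 2 2" and ev: "proots (char_poly A) = {#a, b#}"
  shows "eigenvalue A a" and "A $$ (0,0) + A $$ (1,1) = a + b"
proof -
  have "lead_coeff (char_poly A) = 1"
    using char_poly_mat_2[OF A] by simp
  then have "char_poly A = (\<Prod>x\<in>#proots (char_poly A). [:-x, 1:])"
    using complex_poly_decompose_multiset[of "char_poly A"] by simp
  then have cp: "char_poly A = [:-a, 1:] * [:-b, 1:]"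
    by (simp add: ev)
  then show "eigenvalue A a"
    using eigenvalue_root_char_poly[OF A] by simp
  from cp show "A $$ (0,0) + A $$ (1,1) = a + b"
    using char_poly_mat_2[OF A] by (simp add: algebra_simps)
qed

section \<open>Numerical range and trace in coordinates\<close>

definition qform_2 :: "complex \<Rightarrow> complex \<Rightarrow> complex \<Rightarrow> complex \<Rightarrow> complex \<Rightarrow> complex \<Rightarrow> complex" where
  "qform_2 p q r s x y = (p * x + q * y) * cnj x + (r * x + s * y) * cnj y"

lemma numerical_range_mat_2:
  assumes A: "A \<in> carrier_mat 2 2"
  shows "numerical_range A =
    {qform_2 (A $$ (0,0)) (A $$ (0,1)) (A $$ (1,0)) (A $$ (1,1)) x y | x y.
       (cmod x)\<^sup>2 + (cmod y)\<^sup>2 = 1}" (is "_ = ?R")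
proof
  have form: "(A *\<^sub>v v) \<bullet>c v =
      qform_2 (A $$ (0,0)) (A $$ (0,1)) (A $$ (1,0)) (A $$ (1,1)) (v $ 0) (v $ 1)"
    and norm: "vec_l2norm v = 1 \<longleftrightarrow> (cmod (v $ 0))\<^sup>2 + (cmod (v $ 1))\<^sup>2 = 1"
    if "v \<in> carrier_vec 2" for v
    using A that
    by (auto simp: qform_2_def vec_l2norm_def scalar_prod_def numeral_2_eq_2 lessThan_Suc)
  show "numerical_range A \<subseteq> ?R"
    using A form norm unfolding numerical_range_def by auto
  show "?R \<subseteq> numerical_range A"
  proof
    fix z assume "z \<in> ?R"
    then obtain x y where z: "z = qform_2 (A $$ (0,0)) (A $$ (0,1)) (A $$ (1,0)) (A $$ (1,1)) x y"
      and xy: "(cmod x)\<^sup>2 + (cmod y)\<^sup>2 = 1" by blast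
    define v where "v = vec_of_list [x, y]"
    have v: "v \<in> carrier_vec 2" "v $ 0 = x" "v $ 1 = y"
      unfolding v_def by (auto intro: carrier_vecI)
    then show "z \<in> numerical_range A"
      using A form[OF v(1)] norm[OF v(1)] z xy unfolding numerical_range_def
      by (auto intro!: exI[of _ v])
  qed
qed

lemma mat_tr_adjoint_mult_mat_2:
  assumes "A \<in> carrier_mat 2 2"
  shows "mat_tr (mat_adjoint A * A) = of_real ((cmod (A $$ (0,0)))\<^sup>2 + (cmod (A $$ (0,1)))\<^sup>2
           + (cmod (A $$ (1,0)))\<^sup>2 + (cmod (A $$ (1,1)))\<^sup>2)"
proof -
  have "dim_row A = 2" "dim_col A = 2"
    using assms by auto
  then show ?thesis
    unfolding of_real_add complex_norm_square
    by (simp add: mat_tr_def mat_adjoint_def mat_of_rows_def scalar_prod_def numeral_2_eq_2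
        lessThan_Suc ac_simps)
qed

section \<open>Unitary triangularization\<close>

lemma unit_eigenvector_mat_2:
  fixes A :: "complex mat"
  assumes A: "A \<in> carrier_mat 2 2" and ev: "eigenvalue A a"
  obtains v w where "v * cnj v + w * cnj w = 1"
    "A $$ (0,0) * v + A $$ (0,1) * w = a * v" "A $$ (1,0) * v + A $$ (1,1) * w = a * w"
proof -
  from ev obtain u where u: "u \<in> carrier_vec 2" "u \<noteq> 0\<^sub>v 2" "A *\<^sub>v u = a \<cdot>\<^sub>v u"
    using A unfolding eigenvalue_def eigenvector_def by auto
  define n where "n = sqrt ((cmod (u $ 0))\<^sup>2 + (cmod (u $ 1))\<^sup>2)"
  have "u $ 0 \<noteq> 0 \<or> u $ 1 \<noteq> 0"
  proof (rule ccontr)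
    assume "\<not> ?thesis"
    then have "u = 0\<^sub>v 2"
      using u(1) by (intro eq_vecI) (auto simp: less_2_cases_iff)
    with u(2) show False by simp
  qed
  then have n: "n > 0"
    unfolding n_def by (auto simp: add_pos_nonneg add_nonneg_pos)
  have eq: "A $$ (0,0) * u $ 0 + A $$ (0,1) * u $ 1 = a * u $ 0"
    "A $$ (1,0) * u $ 0 + A $$ (1,1) * u $ 1 = a * u $ 1"
    using arg_cong[OF u(3), of "\<lambda>x. x $ 0"] arg_cong[OF u(3), of "\<lambda>x. x $ 1"] A u(1)
    by (auto simp: scalar_prod_def numeral_2_eq_2)
  have n2: "u $ 0 * cnj (u $ 0) + u $ 1 * cnj (u $ 1) = (of_real n)\<^sup>2"
    unfolding complex_norm_square[symmetric] of_real_power[symmetric] of_real_add[symmetric]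
    by (simp only: n_def real_sqrt_pow2 sum_power2_ge_zero)
  show thesis
  proof
    show "(u $ 0 / of_real n) * cnj (u $ 0 / of_real n)
        + (u $ 1 / of_real n) * cnj (u $ 1 / of_real n) = 1"
      using n n2 by (simp add: power2_eq_square flip: add_divide_distrib)
  qed (use eq in \<open>simp_all flip: add_divide_distrib\<close>)
qed

text \<open>
  The four equations are the entries of \<open>A = U T U\<^sup>*\<close> for the unitary matrix \<open>U\<close> with rows
  \<open>(v, - cnj w)\<close>, \<open>(w, cnj v)\<close> and the triangular matrix \<open>T\<close> with rows \<open>(a, c)\<close>, \<open>(0, b)\<close>.
\<close>

lemma schur_mat_2:
  fixes A :: "complex mat"
  assumes A: "A \<in> carrier_mat 2 2" and ev: "proots (char_poly A) = {#a, b#}"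
  obtains c v w where "v * cnj v + w * cnj w = 1"
    "A $$ (0,0) = a * v * cnj v - c * v * w + b * w * cnj w"
    "A $$ (0,1) = a * v * cnj w + c * v\<^sup>2 - b * v * cnj w"
    "A $$ (1,0) = a * w * cnj v - c * w\<^sup>2 - b * w * cnj v"
    "A $$ (1,1) = a * w * cnj w + c * v * w + b * v * cnj v"
proof -
  obtain v w where vw: "v * cnj v + w * cnj w = 1"
    "A $$ (0,0) * v + A $$ (0,1) * w = a * v" "A $$ (1,0) * v + A $$ (1,1) * w = a * w"
    using unit_eigenvector_mat_2[OF A eigenvalues_mat_2(1)[OF A ev]] .
  note tr = eigenvalues_mat_2(2)[OF A ev]
  \<comment> \<open>\<open>(k\<^sub>1, k\<^sub>2)\<close> is the image of the unit vector \<open>(- cnj w, cnj v)\<close>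
    orthogonal to the eigenvector \<open>(v, w)\<close>.\<close>
  define k\<^sub>1 k\<^sub>2 where "k\<^sub>1 = A $$ (0,1) * cnj v - A $$ (0,0) * cnj w"
    and "k\<^sub>2 = A $$ (1,1) * cnj v - A $$ (1,0) * cnj w"
  define c where "c = k\<^sub>1 * cnj v + k\<^sub>2 * cnj w"
  \<comment> \<open>The trace gives \<open>b\<close>; the factors equal to 1 make room for the
    eigenvector equations. Thus \<open>b\<close> is the component of
    \<open>(k\<^sub>1, k\<^sub>2)\<close> along \<open>(- cnj w, cnj v)\<close>, as \<open>c\<close>
    is along \<open>(v, w)\<close>.\<close>
  have "b = (A $$ (0,0) + A $$ (1,1)) * (v * cnj v + w * cnj w) - a * (v * cnj v + w * cnj w)"
    using tr vw(1) by simp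
  also have "\<dots> = (A $$ (0,0) + A $$ (1,1)) * (v * cnj v + w * cnj w)
      - (a * v) * cnj v - (a * w) * cnj w"
    by (simp add: algebra_simps)
  also have "\<dots> = v * k\<^sub>2 - w * k\<^sub>1"
    unfolding vw(2,3)[symmetric] k\<^sub>1_def k\<^sub>2_def by (simp add: algebra_simps)
  finally have b: "b = v * k\<^sub>2 - w * k\<^sub>1" .
  have "v * c - b * cnj w = k\<^sub>1 * (v * cnj v + w * cnj w)"
    "w * c + b * cnj v = k\<^sub>2 * (v * cnj v + w * cnj w)"
    unfolding b c_def by (simp_all add: algebra_simps)
  then have k: "k\<^sub>1 = v * c - b * cnj w" "k\<^sub>2 = w * c + b * cnj v"
    using vw(1) by simp_all
  \<comment> \<open>Entries of A = (A U) U^*, where A U has the columns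
    \<open>(a * v, a * w)\<close> and \<open>(k\<^sub>1, k\<^sub>2)\<close>.\<close>
  have "A $$ (0,0) * (v * cnj v + w * cnj w) = (a * v) * cnj v - w * k\<^sub>1"
    "A $$ (0,1) * (v * cnj v + w * cnj w) = (a * v) * cnj w + v * k\<^sub>1"
    "A $$ (1,0) * (v * cnj v + w * cnj w) = (a * w) * cnj v - w * k\<^sub>2"
    "A $$ (1,1) * (v * cnj v + w * cnj w) = (a * w) * cnj w + v * k\<^sub>2"
    unfolding vw(2,3)[symmetric] k\<^sub>1_def k\<^sub>2_def by (simp_all add: algebra_simps)
  then show thesis
    using that[of v w c] vw(1) unfolding k by (simp add: algebra_simps power2_eq_square)
qed

section \<open>The triangular case and the ellipse\<close>

lemma elliptical_disk_iff:
  "z \<in> elliptical_disk a b (cmod c) \<longleftrightarrow>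
    (\<exists>t\<in>{0..1}. (cmod (z - (of_real t * a + of_real (1 - t) * b)))\<^sup>2 = t * (1 - t) * (cmod c)\<^sup>2)"
proof -
  define P Q S where "P = cmod (z - a)" and "Q = cmod (z - b)"
    and "S = (cmod (a - b))\<^sup>2 + (cmod c)\<^sup>2"
  define f where "f t = t * P\<^sup>2 + (1 - t) * Q\<^sup>2 - t * (1 - t) * S" for t
  have PQ: "P \<ge> 0" "Q \<ge> 0" "S \<ge> 0"
    by (simp_all add: P_def Q_def S_def)
  \<comment> \<open>Stewart's theorem for the point dividing the segment from \<open>b\<close> to \<open>a\<close>.\<close>
  have stewart: "(cmod (z - (of_real t * a + of_real (1 - t) * b)))\<^sup>2 - t * (1 - t) * (cmod c)\<^sup>2 = f t"
    for t
    unfolding f_def P_def Q_def S_def cmod_power2 by (simp add: power2_eq_square algebra_simps)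
  have "P + Q \<le> sqrt S \<longleftrightarrow> (\<exists>t\<in>{0..1}. f t = 0)"
  proof
    assume "P + Q \<le> sqrt S"
    then have le: "(P + Q)\<^sup>2 \<le> S"
      using PQ by (metis add_nonneg_nonneg power_mono real_sqrt_pow2)
    show "\<exists>t\<in>{0..1}. f t = 0"
    proof (cases "P + Q = 0")
      case True
      then have "f 0 = 0" using PQ by (simp add: f_def)
      then show ?thesis by force
    next
      case False
      \<comment> \<open>The equality case of Cauchy-Schwarz:
        \<open>t * P = (1 - t) * Q\<close>.\<close>
      define t where "t = Q / (P + Q)"
      have pos: "P + Q > 0" using False PQ by simp
      have t: "0 \<le> t" "t \<le> 1" "1 - t = P / (P + Q)"
        using PQ pos by (auto simp: t_def field_simps)
      have "t * (1 - t) * (P + Q)\<^sup>2 = t * P\<^sup>2 + (1 - t) * Q\<^sup>2"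
        unfolding t(3) using pos by (simp add: t_def field_simps power2_eq_square)
      moreover have "t * (1 - t) * (P + Q)\<^sup>2 \<le> t * (1 - t) * S"
        using t(1,2) le by (intro mult_left_mono) auto
      ultimately have "f t \<le> 0" by (simp add: f_def)
      moreover have "0 \<le> f 0" by (simp add: f_def)
      moreover have "continuous_on {0..t} f"
        unfolding f_def by (intro continuous_intros)
      ultimately obtain s where "0 \<le> s" "s \<le> t" "f s = 0"
        using IVT2'[of f t 0 0] t(1) by blast
      with t(2) show ?thesis by force
    qed
  next
    assume "\<exists>t\<in>{0..1}. f t = 0"
    then obtain t where t: "0 \<le> t" "t \<le> 1" and ft: "f t = 0" by auto
    have "(P + Q)\<^sup>2 \<le> S"
    \<comment> \<open>At the endpoints \<open>t * (1 - t)\<close> cannot be cancelled, but there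
      \<open>z\<close> is a focus.\<close>
    proof (cases "t = 0 \<or> t = 1")
      case True
      have "(P + Q)\<^sup>2 = (cmod (a - b))\<^sup>2"
      proof -
        consider "z = b" | "z = a"
          using True ft by (auto simp: f_def P_def Q_def)
        then show ?thesis
          by cases (auto simp: P_def Q_def norm_minus_commute)
      qed
      then show ?thesis by (simp add: S_def)
    next
      case False
      with t have pos: "t * (1 - t) > 0" by simp
      \<comment> \<open>The subtracted square is the defect in Cauchy-Schwarz.\<close>
      have "t * (1 - t) * (P + Q)\<^sup>2 = t * (1 - t) * S - (t * P - (1 - t) * Q)\<^sup>2"
        using ft unfolding f_def by (simp add: algebra_simps power2_eq_square)
      then have "t * (1 - t) * (P + Q)\<^sup>2 \<le> t * (1 - t) * S" by simp
      with pos show ?thesis by (rule mult_left_le_imp_le[rotated])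
    qed
    then show "P + Q \<le> sqrt S" by (rule real_le_rsqrt)
  qed
  moreover have "(cmod (z - (of_real t * a + of_real (1 - t) * b)))\<^sup>2 = t * (1 - t) * (cmod c)\<^sup>2
      \<longleftrightarrow> f t = 0" for t
    using stewart[of t] by linarith
  ultimately show ?thesis
    by (simp add: elliptical_disk_def P_def Q_def S_def)
qed

lemma numerical_range_triangular_2:
  "{qform_2 a c 0 b x y | x y. (cmod x)\<^sup>2 + (cmod y)\<^sup>2 = 1} = elliptical_disk a b (cmod c)"
  (is "?L = _")
proof (intro equalityI subsetI)
  fix z assume "z \<in> ?L"
  then obtain x y where z: "z = qform_2 a c 0 b x y" and xy: "(cmod x)\<^sup>2 + (cmod y)\<^sup>2 = 1"
    by blast
  define t where "t = (cmod x)\<^sup>2"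
  have t: "0 \<le> t" "t \<le> 1" "1 - t = (cmod y)\<^sup>2"
    by (simp_all add: t_def flip: xy)
  have "z - (of_real t * a + of_real (1 - t) * b) = c * y * cnj x"
    unfolding t(3) unfolding t_def complex_norm_square z qform_2_def by (simp add: algebra_simps)
  then have "(cmod (z - (of_real t * a + of_real (1 - t) * b)))\<^sup>2 = t * (1 - t) * (cmod c)\<^sup>2"
    unfolding t(3) by (simp add: norm_mult power_mult_distrib t_def)
  with t show "z \<in> elliptical_disk a b (cmod c)"
    unfolding elliptical_disk_iff by (intro bexI[of _ t]) auto
next
  fix z assume "z \<in> elliptical_disk a b (cmod c)"
  then obtain t where t: "0 \<le> t" "t \<le> 1"
    and eq: "(cmod (z - (of_real t * a + of_real (1 - t) * b)))\<^sup>2 = t * (1 - t) * (cmod c)\<^sup>2"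
    unfolding elliptical_disk_iff by auto
  define d where "d = z - (of_real t * a + of_real (1 - t) * b)"
  \<comment> \<open>The phase rotating \<open>c\<close> to the direction of \<open>d\<close>. If
    \<open>c\<close> or \<open>d\<close> is 0, both sides of the formula for \<open>d\<close> below
    vanish, so the value of \<open>Arg 0\<close> is harmless.\<close>
  define e where "e = cis (Arg d - Arg c)"
  have "cmod d = sqrt t * sqrt (1 - t) * cmod c"
    using t eq unfolding d_def[symmetric]
    by (metis abs_norm_cancel real_sqrt_abs real_sqrt_mult)
  then have "d = of_real (sqrt t * sqrt (1 - t) * cmod c) * cis (Arg d)"
    using rcis_cmod_Arg[of d] by (simp add: rcis_def)
  also have "cis (Arg d) = e * cis (Arg c)"
    by (simp add: e_def cis_mult)
  also have "of_real (sqrt t * sqrt (1 - t) * cmod c) * (e * cis (Arg c))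
      = of_real (sqrt t * sqrt (1 - t)) * e * rcis (cmod c) (Arg c)"
    by (simp add: rcis_def)
  finally have d: "d = of_real (sqrt t * sqrt (1 - t)) * e * c"
    by (simp only: rcis_cmod_Arg)
  define x y where "x = complex_of_real (sqrt t)" and "y = of_real (sqrt (1 - t)) * e"
  have norm: "(cmod x)\<^sup>2 = t" "(cmod y)\<^sup>2 = 1 - t"
    using t by (simp_all add: x_def y_def e_def norm_mult)
  have "z = of_real ((cmod x)\<^sup>2) * a + of_real ((cmod y)\<^sup>2) * b + c * y * cnj x"
    using d unfolding norm unfolding d_def x_def y_def by (simp add: algebra_simps)
  then have "z = qform_2 a c 0 b x y"
    unfolding complex_norm_square qform_2_def by (simp add: algebra_simps)
  with norm show "z \<in> ?L" by force
qed

section \<open>Unitary invariance\<close>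

lemma qform_2_unitary:
  assumes "v * cnj v + w * cnj w = 1"
    "p = a * v * cnj v - c * v * w + b * w * cnj w"
    "q = a * v * cnj w + c * v\<^sup>2 - b * v * cnj w"
    "r = a * w * cnj v - c * w\<^sup>2 - b * w * cnj v"
    "s = a * w * cnj w + c * v * w + b * v * cnj v"
  shows "{qform_2 p q r s x y | x y. (cmod x)\<^sup>2 + (cmod y)\<^sup>2 = 1} =
         {qform_2 a c 0 b x y | x y. (cmod x)\<^sup>2 + (cmod y)\<^sup>2 = 1}"
proof -
  \<comment> \<open>The new arguments are U^* applied to \<open>(x, y)\<close>, with U as in
    \<open>schur_mat_2\<close>; it remains to see that U^* maps the unit sphere onto itself.\<close>
  have form: "qform_2 p q r s x y = qform_2 a c 0 b (cnj v * x + cnj w * y) (v * y - w * x)" for x y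
    unfolding assms(2-5) qform_2_def by (simp add: algebra_simps power2_eq_square)
  have unit: "(cmod x)\<^sup>2 + (cmod y)\<^sup>2 = 1 \<longleftrightarrow> x * cnj x + y * cnj y = 1" for x y
    unfolding complex_norm_square[symmetric] of_real_add[symmetric] by (simp only: of_real_eq_1_iff)
  have "(cnj v * x + cnj w * y) * cnj (cnj v * x + cnj w * y) + (v * y - w * x) * cnj (v * y - w * x)
      = (x * cnj x + y * cnj y) * (v * cnj v + w * cnj w)" for x y
    by (simp add: algebra_simps)
  then have "(cmod (cnj v * x + cnj w * y))\<^sup>2 + (cmod (v * y - w * x))\<^sup>2 = 1"
    if "(cmod x)\<^sup>2 + (cmod y)\<^sup>2 = 1" for x y
    using that assms(1) unfolding unit by simp
  moreover have "\<exists>x' y'. (cmod x')\<^sup>2 + (cmod y')\<^sup>2 = 1 \<and> x = cnj v * x' + cnj w * y' \<and> y = v * y' - w * x'"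
    if "(cmod x)\<^sup>2 + (cmod y)\<^sup>2 = 1" for x y
  proof (intro exI conjI)
    \<comment> \<open>The preimage is U applied to \<open>(x, y)\<close>.\<close>
    have "(v * x - cnj w * y) * cnj (v * x - cnj w * y) + (w * x + cnj v * y) * cnj (w * x + cnj v * y)
        = (x * cnj x + y * cnj y) * (v * cnj v + w * cnj w)"
      by (simp add: algebra_simps)
    then show "(cmod (v * x - cnj w * y))\<^sup>2 + (cmod (w * x + cnj v * y))\<^sup>2 = 1"
      using that assms(1) unfolding unit by simp
    have "cnj v * (v * x - cnj w * y) + cnj w * (w * x + cnj v * y) = x * (v * cnj v + w * cnj w)"
      "v * (w * x + cnj v * y) - w * (v * x - cnj w * y) = y * (v * cnj v + w * cnj w)"
      by (simp_all add: algebra_simps)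
    then show "x = cnj v * (v * x - cnj w * y) + cnj w * (w * x + cnj v * y)"
      "y = v * (w * x + cnj v * y) - w * (v * x - cnj w * y)"
      by (simp_all only: assms(1) mult_1_right)
  qed
  ultimately show ?thesis
    unfolding form by blast
qed

lemma frobenius_norm_unitary_2:
  assumes "v * cnj v + w * cnj w = 1"
    "p = a * v * cnj v - c * v * w + b * w * cnj w"
    "q = a * v * cnj w + c * v\<^sup>2 - b * v * cnj w"
    "r = a * w * cnj v - c * w\<^sup>2 - b * w * cnj v"
    "s = a * w * cnj w + c * v * w + b * v * cnj v"
  shows "(cmod p)\<^sup>2 + (cmod q)\<^sup>2 + (cmod r)\<^sup>2 + (cmod s)\<^sup>2 = (cmod a)\<^sup>2 + (cmod b)\<^sup>2 + (cmod c)\<^sup>2"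
proof -
  \<comment> \<open>U and U^* each contribute one factor \<open>v * cnj v + w * cnj w\<close>, hence
    the square.\<close>
  have "p * cnj p + q * cnj q + r * cnj r + s * cnj s =
      (a * cnj a + b * cnj b + c * cnj c) * (v * cnj v + w * cnj w)\<^sup>2"
    unfolding assms(2-5) by (simp add: algebra_simps power2_eq_square)
  then have "p * cnj p + q * cnj q + r * cnj r + s * cnj s = a * cnj a + b * cnj b + c * cnj c"
    by (simp add: assms(1))
  then show ?thesis
    unfolding complex_norm_square[symmetric] of_real_add[symmetric] by (simp only: of_real_eq_iff)
qed

theorem theorem1p4:
  fixes A :: "complex mat" and a b :: complex
  assumes "A \<in> carrier_mat 2 2"
    and "proots (char_poly A) = {#a, b#}"
  shows "mat_tr (mat_adjoint A * A) \<in> \<real>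
    \<and> 0 \<le> Re (mat_tr (mat_adjoint A * A)) - (cmod a)\<^sup>2 - (cmod b)\<^sup>2
    \<and> numerical_range A =
        elliptical_disk a b (sqrt (Re (mat_tr (mat_adjoint A * A)) - (cmod a)\<^sup>2 - (cmod b)\<^sup>2))"
proof -
  obtain c v w where schur: "v * cnj v + w * cnj w = 1"
    "A $$ (0,0) = a * v * cnj v - c * v * w + b * w * cnj w"
    "A $$ (0,1) = a * v * cnj w + c * v\<^sup>2 - b * v * cnj w"
    "A $$ (1,0) = a * w * cnj v - c * w\<^sup>2 - b * w * cnj v"
    "A $$ (1,1) = a * w * cnj w + c * v * w + b * v * cnj v"
    using schur_mat_2[OF assms] .
  have "mat_tr (mat_adjoint A * A) = of_real ((cmod a)\<^sup>2 + (cmod b)\<^sup>2 + (cmod c)\<^sup>2)"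
    unfolding mat_tr_adjoint_mult_mat_2[OF assms(1)] frobenius_norm_unitary_2[OF schur] ..
  moreover have "numerical_range A = elliptical_disk a b (cmod c)"
    unfolding numerical_range_mat_2[OF assms(1)] qform_2_unitary[OF schur]
      numerical_range_triangular_2 ..
  ultimately show ?thesis by simp
qed

end
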